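(* Let $\mathcal{F}$ be a real Hilbert space of functions on $\mathcal{X}$, let $\mathcal{H}$ be the reproducing kernel Hilbert space of a bounded positive semidefinite kernel $k$ on $\mathcal{X}$, and let $\mu:\mathcal{F}\to\mathcal{H}$, $\mu(f)=\int_{\mathcal{X}}k(x,\cdot)f(x)\,d\nu(x)$, be the kernel mean embedding, a bounded linear operator. Let $\phi:[0,\infty)\to\mathbb{R}$ be twice continuously differentiable on $[0,\infty)$ and nondecreasing, with $\phi'(0)=0$, $\phi'(r)>0$ and $\phi''(r)>0$ for $r>0$, and let $\Phi:\mathcal{F}\to\mathbb{R}$, $\Phi(f)=\phi(\|\mu(f)\|_{\mathcal{H}})$. For $R>0$ let $\mathcal{P}_R=\{p\in\mathcal{A}:\|\mu(p)\|_{\mathcal{H}}\le R\}$, where $\mathcal{A}=\operatorname{int}(\operatorname{dom}\Phi)$ $(=\mathcal{F})$. For $r>0$ let $\lambda^\perp(r)=\phi'(r)/r$ and $\lambda^\parallel(r)=\phi''(r)$, let $\lambda^\perp(0)=\lambda^\parallel(0)=\phi''(0)$, and set $$L_\phi(R)=\sup_{0\le r\le R}\max\{\lambda^\parallel(r),\lambda^\perp(r)\},\qquad m_\phi(R)=\inf_{0\le r\le R}\min\{\lambda^\parallel(r),\lambda^\perp(r)\}.$$ Then for every $R>0$ and every $p,q\in\mathcal{P}_R$, $$\frac{m_\phi(R)}{2}\,\mathrm{MMD}_k^2(p,q)\ \le\ d_\Phi(p,q)\ \le\ \frac{L_\phi(R)}{2}\,\mathrm{MMD}_k^2(p,q).$$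 In particular, if $m_\phi(R)>0$ and $L_\phi(R)<\infty$, then $d_\Phi$ is uniformly comparable to $\mathrm{MMD}_k^2$ on $\mathcal{P}_R$ (i.e. bounded above and below by positive constant multiples of it).
   Context: Here $\mathcal{X}\subseteq\mathbb{R}^d$ carries a measure $\nu$; it is a standing assumption that $\mu$ is a well-defined bounded linear operator. The squared maximum mean discrepancy is $\mathrm{MMD}_k^2(p,q)=\|\mu(p)-\mu(q)\|_{\mathcal{H}}^2$. The functional Bregman divergence generated by $\Phi$ is $$d_\Phi(f,g)=\Phi(f)-\Phi(g)-\langle\nabla\Phi(g),f-g\rangle_{\mathcal{F}},$$ with $\nabla\Phi(g)\in\mathcal{F}$ the Fréchet gradient of $\Phi$ at $g$ (Riesz representer of the Fréchet derivative). *)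

theory Defs
  imports "HOL-Analysis.Analysis"
begin

text \<open>
  A Hilbert space of real functions on \<open>X\<close> is a Hilbert space type together with an
  evaluation map \<open>ev\<close>. It is linear, and an element is determined by its values on \<open>X\<close>;
  the values of \<open>ev f\<close> outside \<open>X\<close> are irrelevant.
\<close>

definition function_space_on :: "'x set \<Rightarrow> ('f::real_vector \<Rightarrow> 'x \<Rightarrow> real) \<Rightarrow> bool" where
  "function_space_on X ev \<longleftrightarrow>
     (\<forall>x\<in>X. linear (\<lambda>f. ev f x)) \<and>
     (\<forall>f g. (\<forall>x\<in>X. ev f x = ev g x) \<longrightarrow> f = g)"

definition psd_kernel_on :: "'x set \<Rightarrow> ('x \<Rightarrow> 'x \<Rightarrow> real) \<Rightarrow> bool" where
  "psd_kernel_on X k \<longleftrightarrow>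
     (\<forall>x\<in>X. \<forall>y\<in>X. k x y = k y x) \<and>
     (\<forall>S c. finite S \<and> S \<subseteq> X \<longrightarrow> 0 \<le> (\<Sum>x\<in>S. \<Sum>y\<in>S. c x * c y * k x y))"

definition bounded_kernel_on :: "'x set \<Rightarrow> ('x \<Rightarrow> 'x \<Rightarrow> real) \<Rightarrow> bool" where
  "bounded_kernel_on X k \<longleftrightarrow> (\<exists>B. \<forall>x\<in>X. \<forall>y\<in>X. \<bar>k x y\<bar> \<le> B)"

definition rkhs_on ::
  "'x set \<Rightarrow> ('x \<Rightarrow> 'x \<Rightarrow> real) \<Rightarrow> ('h::{real_inner, banach} \<Rightarrow> 'x \<Rightarrow> real) \<Rightarrow> bool" where
  "rkhs_on X k ev \<longleftrightarrow>
     function_space_on X ev \<and>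
     (\<forall>x\<in>X. \<exists>kx. (\<forall>y\<in>X. ev kx y = k x y) \<and> (\<forall>h. inner h kx = ev h x))"

text \<open>
  The equation \<open>\<mu> f = \<integral> k(x,\<cdot>) f(x) d\<nu>(x)\<close> is read as an equation between functions on
  \<open>X = space \<nu>\<close>. A Bochner or weak integral in the reproducing kernel Hilbert space
  satisfies it, and it needs no separability of that space.
\<close>

definition kernel_mean_embedding ::
  "'x measure \<Rightarrow> ('x \<Rightarrow> 'x \<Rightarrow> real) \<Rightarrow> ('f \<Rightarrow> 'x \<Rightarrow> real) \<Rightarrow> ('h \<Rightarrow> 'x \<Rightarrow> real)
    \<Rightarrow> ('f \<Rightarrow> 'h) \<Rightarrow> bool" where
  "kernel_mean_embedding \<nu> k evF evH \<mu> \<longleftrightarrow>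
     (\<forall>f. \<forall>y\<in>space \<nu>. has_bochner_integral \<nu> (\<lambda>x. k x y * evF f x) (evH (\<mu> f) y))"

definition mmd_sq :: "('f \<Rightarrow> 'h::real_normed_vector) \<Rightarrow> 'f \<Rightarrow> 'f \<Rightarrow> real" where
  "mmd_sq \<mu> p q = (norm (\<mu> p - \<mu> q))\<^sup>2"

definition frechet_gradient :: "('f::real_inner \<Rightarrow> real) \<Rightarrow> 'f \<Rightarrow> 'f" where
  "frechet_gradient \<Phi> g = (THE D. GDERIV \<Phi> g :> D)"

lemma frechet_gradient_eqI:
  assumes "GDERIV \<Phi> g :> D"
  shows "frechet_gradient \<Phi> g = D"
  unfolding frechet_gradient_def
proof (rule the_equality[where P = "\<lambda>D. GDERIV \<Phi> g :> D", OF assms])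
  fix E assume "GDERIV \<Phi> g :> E"
  then have "(\<lambda>h. inner h E) = (\<lambda>h. inner h D)"
    using assms unfolding gderiv_def by (rule has_derivative_unique)
  then have "inner (E - D) E = inner (E - D) D"
    by (rule fun_cong)
  then have "inner (E - D) (E - D) = 0"
    by (simp add: inner_diff_right)
  then show "E = D" by simp
qed

definition bregman_div :: "('f::real_inner \<Rightarrow> real) \<Rightarrow> 'f \<Rightarrow> 'f \<Rightarrow> real" where
  "bregman_div \<Phi> f g = \<Phi> f - \<Phi> g - inner (frechet_gradient \<Phi> g) (f - g)"

text \<open>
  The functionals considered are real-valued on the whole space, so their effective domain is
  \<open>UNIV\<close>; the ball is taken in the interior of that domain.
\<close>

definition mmd_ball :: "('f::real_inner \<Rightarrow> 'h::real_normed_vector) \<Rightarrow> real \<Rightarrow> 'f set" where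
  "mmd_ball \<mu> R = {p \<in> interior UNIV. norm (\<mu> p) \<le> R}"

text \<open>
  Below, \<open>\<phi>'\<close> and \<open>\<phi>''\<close> stand for the first and second derivative of the profile
  \<open>\<phi>\<close> on \<open>[0,\<infinity>)\<close>.
\<close>

definition lambda_perp :: "(real \<Rightarrow> real) \<Rightarrow> (real \<Rightarrow> real) \<Rightarrow> real \<Rightarrow> real" where
  "lambda_perp \<phi>' \<phi>'' r = (if r = 0 then \<phi>'' 0 else \<phi>' r / r)"

definition lambda_par :: "(real \<Rightarrow> real) \<Rightarrow> real \<Rightarrow> real" where
  "lambda_par \<phi>'' r = \<phi>'' r"

text \<open>The supremum and infimum are taken in the extended reals, so that no finiteness is presupposed.\<close>

definition L_const :: "(real \<Rightarrow> real) \<Rightarrow> (real \<Rightarrow> real) \<Rightarrow> real \<Rightarrow> ereal" where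
  "L_const \<phi>' \<phi>'' R = (SUP r\<in>{0..R}. ereal (max (lambda_par \<phi>'' r) (lambda_perp \<phi>' \<phi>'' r)))"

definition m_const :: "(real \<Rightarrow> real) \<Rightarrow> (real \<Rightarrow> real) \<Rightarrow> real \<Rightarrow> ereal" where
  "m_const \<phi>' \<phi>'' R = (INF r\<in>{0..R}. ereal (min (lambda_par \<phi>'' r) (lambda_perp \<phi>' \<phi>'' r)))"

end

theory Submission imports Defs begin

text \<open>
  Put \<open>u = \<mu> p\<close>, \<open>v = \<mu> q\<close>, \<open>a = \<parallel>u\<parallel>\<close>, \<open>b = \<parallel>v\<parallel>\<close> and let \<open>\<delta> = a b - \<langle>u,v\<rangle> \<ge> 0\<close> be the Cauchy--Schwarz
  defect. Then the divergence is \<open>(\<phi> a - \<phi> b - \<phi>' b (a - b)) + \<lambda>\<^sup>\<bottom>(b) \<delta>\<close>, while the squared MMD is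
  \<open>(a - b)\<^sup>2 + 2 \<delta>\<close>. The radial parts are compared by a scalar Taylor estimate for \<open>\<phi>\<close>, the
  coefficients of \<open>\<delta>\<close> by the bounds on \<open>\<lambda>\<^sup>\<bottom>\<close>; no second derivative on the Hilbert space is needed.
\<close>

subsection \<open>Riesz representation\<close>

text \<open>The representer is obtained as the minimiser of \<open>\<parallel>x\<parallel>\<^sup>2 - 2 l x\<close>; minimising sequences are
  Cauchy by the parallelogram identity.\<close>

lemma riesz_representation:
  fixes l :: "'a::{real_inner, banach} \<Rightarrow> real"
  assumes "bounded_linear l"
  shows "\<exists>D. \<forall>h. l h = inner h D"
proof -
  interpret l: bounded_linear l by fact
  obtain K where K: "\<And>x. norm (l x) \<le> norm x * K"
    using l.bounded by blast
  define J where "J x = (norm x)\<^sup>2 - 2 * l x" for x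
  \<comment> \<open>Completing the square: \<open>J x\<close> is at least
    \<open>(norm x - K)\<^sup>2 - K\<^sup>2\<close>. Hence the infimum \<open>d\<close> below is a
    genuine one.\<close>
  have lower: "- K\<^sup>2 \<le> J x" for x
  proof -
    have "l x \<le> norm x * K" using K[of x] by simp
    moreover have "0 \<le> (norm x - K)\<^sup>2" by simp
    ultimately show ?thesis by (simp add: J_def power2_diff)
  qed
  define d where "d = Inf (range J)"
  have bdd: "bdd_below (range J)" using lower by (intro bdd_belowI2)
  have d_le: "d \<le> J x" for x
    unfolding d_def using bdd by (intro cInf_lower) auto
  have "\<exists>x. J x < d + 1 / Suc n" for n
    using cInf_lessD[of "range J" "d + 1 / Suc n"] by (auto simp: d_def)
  then obtain x where x: "\<And>n. J (x n) < d + 1 / Suc n" by metis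
  \<comment> \<open>The linear terms of \<open>J\<close> cancel, since \<open>l y + l z\<close> is
    twice the value of \<open>l\<close> at the midpoint. As \<open>J\<close> is at least
    \<open>d\<close> at the midpoint, two near-minimisers must be close to each other.\<close>
  have parallelogram: "(norm (y - z))\<^sup>2 = 2 * J y + 2 * J z - 4 * J ((1/2) *\<^sub>R (y + z))" for y z
    by (simp add: J_def power2_norm_eq_inner inner_simps l.add l.scaleR inner_commute[of z y]
        field_simps)
  have close: "(norm (x m - x n))\<^sup>2 \<le> 4 / Suc N" if "N \<le> m" "N \<le> n" for m n N
  proof -
    have "1 / real (Suc m) \<le> 1 / Suc N" "1 / real (Suc n) \<le> 1 / Suc N"
      using that by (auto intro!: divide_left_mono)
    then show ?thesis
      using parallelogram[of "x m" "x n"] x[of m] x[of n] d_le[of "(1/2) *\<^sub>R (x m + x n)"] by linarith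
  qed
  have "Cauchy x"
  proof (rule CauchyI)
    fix e :: real assume "0 < e"
    then obtain N where N: "4 / Suc N < e\<^sup>2"
      using reals_Archimedean[of "e\<^sup>2 / 4"] by (auto simp: field_simps)
    have "norm (x m - x n) < e" if "N \<le> m" "N \<le> n" for m n
      by (rule power2_less_imp_less) (use close[OF that] N \<open>0 < e\<close> in auto)
    then show "\<exists>M. \<forall>m\<ge>M. \<forall>n\<ge>M. norm (x m - x n) < e" by blast
  qed
  then obtain D where D: "x \<longlonglongrightarrow> D"
    using Cauchy_convergent convergent_def by blast
  have "(\<lambda>n. J (x n)) \<longlonglongrightarrow> J D"
    unfolding J_def by (intro tendsto_intros l.tendsto D)
  moreover have "(\<lambda>n. d + 1 / Suc n) \<longlonglongrightarrow> d + 0"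
    by (intro tendsto_add tendsto_const LIMSEQ_Suc[OF lim_1_over_n])
  ultimately have "J D \<le> d"
    using LIMSEQ_le[of "\<lambda>n. J (x n)" "J D" "\<lambda>n. d + 1 / Suc n" "d + 0"] x by (auto intro: less_imp_le)
  then have min: "J D \<le> J y" for y using d_le[of y] by linarith
  have "l h = inner h D" for h
  proof (cases "h = 0")
    case False
    define c where "c = inner h D - l h"
    have N: "0 < inner h h" using False by simp
    have expand: "J (D + t *\<^sub>R h) = J D + 2 * t * c + t\<^sup>2 * inner h h" for t
      by (simp add: J_def c_def power2_norm_eq_inner inner_simps l.add l.scaleR
          inner_commute[of D h])
        (simp add: algebra_simps power2_eq_square)
    \<comment> \<open>The chosen \<open>t\<close> minimises the quadratic
      \<open>2 * t * c + t\<^sup>2 * inner h h\<close>. Minimality of \<open>D\<close> makes its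
      least value, \<open>-(c\<^sup>2 / inner h h)\<close>, nonnegative, which forces
      \<open>c = 0\<close>.\<close>
    have "0 \<le> 2 * (- c / inner h h) * c + (- c / inner h h)\<^sup>2 * inner h h"
      using min[of "D + (- c / inner h h) *\<^sub>R h"] expand[of "- c / inner h h"] by linarith
    also have "\<dots> = - (c\<^sup>2 / inner h h)"
      using N by (simp add: field_simps power2_eq_square)
    finally have "c = 0" using N by (simp add: divide_le_0_iff)
    then show ?thesis by (simp add: c_def)
  qed (simp add: l.zero)
  then show ?thesis by blast
qed

subsection \<open>A scalar Taylor estimate\<close>

lemma has_real_derivative_nonneg_imp_le:
  fixes f f' :: "real \<Rightarrow> real"
  assumes "a \<le> b"
    and der: "\<And>x. x \<in> {a..b} \<Longrightarrow> (f has_real_derivative f' x) (at x within {a..b})"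
    and nonneg: "\<And>x. x \<in> {a..b} \<Longrightarrow> 0 \<le> f' x"
  shows "f a \<le> f b"
proof -
  obtain x where "x \<in> {a..b}" "f b - f a = f' x * (b - a)"
    using mvt_very_simple[OF \<open>a \<le> b\<close>, of f "\<lambda>x. (*) (f' x)"] der
    unfolding has_field_derivative_def by auto
  then show ?thesis using nonneg[of x] \<open>a \<le> b\<close> mult_nonneg_nonneg[of "f' x" "b - a"] by linarith
qed

text \<open>\<open>f'\<close> is nondecreasing, so \<open>f\<close> minus its tangent at
  \<open>b\<close> increases to the right of \<open>b\<close> and decreases to the left of it.
  Derivatives are relative to the closed interval so that an endpoint with only a one-sided
  derivative, such as 0 for the profile, is covered.\<close>

lemma nonneg_second_derivative_imp_above_tangent:
  fixes f f' f'' :: "real \<Rightarrow> real"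
  assumes f: "\<And>x. x \<in> {l..u} \<Longrightarrow> (f has_real_derivative f' x) (at x within {l..u})"
    and f': "\<And>x. x \<in> {l..u} \<Longrightarrow> (f' has_real_derivative f'' x) (at x within {l..u})"
    and f'': "\<And>x. x \<in> {l..u} \<Longrightarrow> 0 \<le> f'' x"
    and a: "a \<in> {l..u}" and b: "b \<in> {l..u}"
  shows "0 \<le> f a - f b - f' b * (a - b)"
proof -
  have mono: "f' x \<le> f' y" if "x \<in> {l..u}" "y \<in> {l..u}" "x \<le> y" for x y
  proof (rule has_real_derivative_nonneg_imp_le[OF \<open>x \<le> y\<close>, where f' = f''])
    fix z assume z: "z \<in> {x..y}"
    then have "z \<in> {l..u}" using that by auto
    then show "0 \<le> f'' z" "(f' has_real_derivative f'' z) (at z within {x..y})"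
      using f'' that by (auto intro!: DERIV_subset[OF f'])
  qed
  show ?thesis
  proof (cases "b \<le> a")
    case True
    have "f b - f' b * (b - b) \<le> f a - f' b * (a - b)"
    proof (rule has_real_derivative_nonneg_imp_le[OF True, where f' = "\<lambda>x. f' x - f' b"])
      fix z assume z: "z \<in> {b..a}"
      then have "z \<in> {l..u}" using a b by auto
      then show "0 \<le> f' z - f' b" using mono[of b z] b z by auto
      have "(f has_real_derivative f' z) (at z within {b..a})"
        using \<open>z \<in> {l..u}\<close> a b by (intro DERIV_subset[OF f]) auto
      then show "((\<lambda>x. f x - f' b * (x - b)) has_real_derivative f' z - f' b) (at z within {b..a})"
        by (auto intro!: derivative_eq_intros)
    qed
    then show ?thesis by simp
  next
    case False
    have "f' b * (a - b) - f a \<le> f' b * (b - b) - f b"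
    proof (rule has_real_derivative_nonneg_imp_le[where a = a and b = b
          and f = "\<lambda>x. f' b * (x - b) - f x" and f' = "\<lambda>x. f' b - f' x"])
      show "a \<le> b" using False by simp
      fix z assume z: "z \<in> {a..b}"
      then have "z \<in> {l..u}" using a b by auto
      then show "0 \<le> f' b - f' z" using mono[of z b] b z by auto
      have "(f has_real_derivative f' z) (at z within {a..b})"
        using \<open>z \<in> {l..u}\<close> a b by (intro DERIV_subset[OF f]) auto
      then show "((\<lambda>x. f' b * (x - b) - f x) has_real_derivative f' b - f' z) (at z within {a..b})"
        by (auto intro!: derivative_eq_intros)
    qed
    then show ?thesis by simp
  qed
qed

text \<open>The tangent remainder of the parabola \<open>c / 2 * x\<^sup>2\<close> is exactly
  \<open>c / 2 * (a - b)\<^sup>2\<close>. Subtracting the parabola from \<open>f\<close> therefore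
  reduces a bound on \<open>f''\<close> to the sign of a second derivative.\<close>

lemma taylor_quadratic_bounds:
  fixes f f' f'' :: "real \<Rightarrow> real"
  assumes f: "\<And>x. x \<in> {l..u} \<Longrightarrow> (f has_real_derivative f' x) (at x within {l..u})"
    and f': "\<And>x. x \<in> {l..u} \<Longrightarrow> (f' has_real_derivative f'' x) (at x within {l..u})"
    and a: "a \<in> {l..u}" and b: "b \<in> {l..u}"
  shows taylor_quadratic_lower: "(\<And>x. x \<in> {l..u} \<Longrightarrow> m \<le> f'' x) \<Longrightarrow>
      m / 2 * (a - b)\<^sup>2 \<le> f a - f b - f' b * (a - b)"
    and taylor_quadratic_upper: "(\<And>x. x \<in> {l..u} \<Longrightarrow> f'' x \<le> M) \<Longrightarrow>
      f a - f b - f' b * (a - b) \<le> M / 2 * (a - b)\<^sup>2"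
proof -
  \<comment> \<open>The sign \<open>s\<close> treats both bounds at once: \<open>s = 1\<close> with
    \<open>c = m\<close> gives the lower one, \<open>s = -1\<close> with \<open>c = M\<close> the
    upper one.\<close>
  have shifted: "0 \<le> s * (f a - f b - f' b * (a - b)) - s * c / 2 * (a - b)\<^sup>2"
    if "\<And>x. x \<in> {l..u} \<Longrightarrow> 0 \<le> s * (f'' x - c)" for s c
  proof -
    have "0 \<le> s * (f a - c / 2 * a\<^sup>2) - s * (f b - c / 2 * b\<^sup>2) - s * (f' b - c * b) * (a - b)"
    proof (rule nonneg_second_derivative_imp_above_tangent[OF _ _ that a b])
      fix x assume x: "x \<in> {l..u}"
      show "((\<lambda>x. s * (f x - c / 2 * x\<^sup>2)) has_real_derivative s * (f' x - c * x)) (at x within {l..u})"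
        using f[OF x] by (auto intro!: derivative_eq_intros)
      show "((\<lambda>x. s * (f' x - c * x)) has_real_derivative s * (f'' x - c)) (at x within {l..u})"
        using f'[OF x] by (auto intro!: derivative_eq_intros)
    qed
    then show ?thesis by (simp add: field_simps power2_eq_square)
  qed
  show "m / 2 * (a - b)\<^sup>2 \<le> f a - f b - f' b * (a - b)" if "\<And>x. x \<in> {l..u} \<Longrightarrow> m \<le> f'' x"
    using shifted[of 1 m] that by auto
  show "f a - f b - f' b * (a - b) \<le> M / 2 * (a - b)\<^sup>2" if "\<And>x. x \<in> {l..u} \<Longrightarrow> f'' x \<le> M"
    using shifted[of "-1" M] that by auto
qed

subsection \<open>Radial functionals\<close>

text \<open>Away from 0 this is the chain rule, with \<open>sgn v = v / norm v\<close> turning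
  \<open>\<phi>' (norm v)\<close> into \<open>lambda_perp\<close>. At 0 the norm is not
  differentiable, but \<open>\<phi>' 0 = 0\<close> makes the increment of \<open>\<phi>\<close>
  small compared with \<open>norm h\<close>, and the claimed derivative is 0 because
  \<open>inner 0 h = 0\<close>.\<close>

lemma has_derivative_radial:
  fixes v :: "'a::real_inner"
  assumes \<phi>: "\<And>r. r \<ge> 0 \<Longrightarrow> (\<phi> has_real_derivative \<phi>' r) (at r within {0..})"
    and "\<phi>' 0 = 0"
  shows "((\<lambda>h. \<phi> (norm h)) has_derivative
      (\<lambda>h. lambda_perp \<phi>' \<phi>'' (norm v) * inner v h)) (at v)"
proof (cases "v = 0")
  case True
  have "((\<lambda>h. \<phi> (norm h)) has_derivative (\<lambda>h. 0)) (at (0::'a))"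
    unfolding has_derivative_at_alt
  proof (intro conjI allI impI)
    fix e :: real assume "0 < e"
    have "(\<phi> has_derivative (\<lambda>h. 0)) (at 0 within {0..})"
      using \<phi>[of 0] \<open>\<phi>' 0 = 0\<close> by (simp add: has_field_derivative_def lambda_zero)
    then obtain d where "0 < d"
      and d: "\<And>r. r \<in> {0..} \<Longrightarrow> norm (r - 0) < d \<Longrightarrow> norm (\<phi> r - \<phi> 0 - 0) \<le> e * norm (r - 0)"
      unfolding has_derivative_within_alt using \<open>0 < e\<close> by blast
    then show "\<exists>d>0. \<forall>y::'a. norm (y - 0) < d \<longrightarrow>
        norm (\<phi> (norm y) - \<phi> (norm (0::'a)) - 0) \<le> e * norm (y - 0)"
      by (intro exI[of _ d]) auto
  qed simp
  with True show ?thesis by simp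
next
  case False
  \<comment> \<open>The one-sided hypothesis becomes a two-sided derivative because
    \<open>norm v\<close> is interior to the half-line.\<close>
  have "(\<phi> has_real_derivative \<phi>' (norm v)) (at (norm v))"
    using \<phi>[of "norm v"] False at_within_interior[of "norm v" "{0..}"] by simp
  moreover have "(norm has_derivative (\<lambda>h. inner (sgn v) h)) (at v)"
    using has_derivative_norm[OF False] by (simp add: inner_commute)
  ultimately have "((\<lambda>h. \<phi> (norm h)) has_derivative (\<lambda>h. \<phi>' (norm v) * inner (sgn v) h)) (at v)"
    unfolding has_field_derivative_def by (rule has_derivative_compose[rotated])
  then show ?thesis
    using False by (simp add: lambda_perp_def sgn_div_norm divide_inverse mult.assoc)
qed

lemma bregman_div_radial_comp:
  fixes \<mu> :: "'f::{real_inner, banach} \<Rightarrow> 'h::real_inner"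
  assumes "bounded_linear \<mu>"
    and \<phi>: "\<And>r. r \<ge> 0 \<Longrightarrow> (\<phi> has_real_derivative \<phi>' r) (at r within {0..})"
    and \<phi>'0: "\<phi>' 0 = 0"
    and \<Phi>: "\<And>f. \<Phi> f = \<phi> (norm (\<mu> f))"
  shows "bregman_div \<Phi> p q =
      (\<phi> (norm (\<mu> p)) - \<phi> (norm (\<mu> q)) - \<phi>' (norm (\<mu> q)) * (norm (\<mu> p) - norm (\<mu> q)))
      + lambda_perp \<phi>' \<phi>'' (norm (\<mu> q)) * (norm (\<mu> p) * norm (\<mu> q) - inner (\<mu> p) (\<mu> q))"
proof -
  interpret \<mu>: bounded_linear \<mu> by fact
  define c where "c = lambda_perp \<phi>' \<phi>'' (norm (\<mu> q))"
  have "bounded_linear (\<lambda>h. c * inner (\<mu> q) (\<mu> h))"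
    by (intro bounded_linear_intros assms(1))
  \<comment> \<open>\<open>D\<close> is \<open>c\<close> times the adjoint of \<mu> applied to
    \<open>\<mu> q\<close>; the Riesz theorem supplies it without constructing the adjoint.\<close>
  from riesz_representation[OF this] obtain D where D: "\<And>h. inner h D = c * inner (\<mu> q) (\<mu> h)"
    by metis
  have "(\<Phi> has_derivative (\<lambda>h. c * inner (\<mu> q) (\<mu> h))) (at q)"
    unfolding \<Phi>[abs_def] c_def
    by (rule has_derivative_compose[OF \<mu>.has_derivative[OF has_derivative_ident]
          has_derivative_radial[OF \<phi> \<phi>'0]])
  then have "frechet_gradient \<Phi> q = D"
    by (intro frechet_gradient_eqI) (simp add: gderiv_def D)
  then have "bregman_div \<Phi> p q = \<Phi> p - \<Phi> q - c * inner (\<mu> q) (\<mu> (p - q))"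
    by (simp add: bregman_div_def D[symmetric] inner_commute)
  \<comment> \<open>True also at norm 0, thanks to \<open>\<phi>' 0 = 0\<close>. With u, v for the
    embeddings of p, q, it splits \<open>c * inner v (u - v)\<close> into the radial tangent term
    minus \<open>c\<close> times the Cauchy-Schwarz defect.\<close>
  moreover have "\<phi>' (norm (\<mu> q)) = c * norm (\<mu> q)"
    by (simp add: c_def lambda_perp_def \<phi>'0)
  ultimately show ?thesis
    by (simp add: \<Phi> c_def[symmetric] \<mu>.diff inner_diff_right power2_norm_eq_inner[symmetric]
        inner_commute[of "\<mu> q"] algebra_simps power2_eq_square)
qed

lemma norm_diff_sq_radial:
  fixes u v :: "'a::real_inner"
  shows "(norm (u - v))\<^sup>2 = (norm u - norm v)\<^sup>2 + 2 * (norm u * norm v - inner u v)"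
  by (simp add: power2_diff power2_norm_eq_inner inner_diff_left inner_diff_right
      inner_commute[of v u])

theorem theorem16:
  fixes X :: "(real ^ 'd) set"
    and \<nu> :: "(real ^ 'd) measure"
    and k :: "real ^ 'd \<Rightarrow> real ^ 'd \<Rightarrow> real"
    and evF :: "'f::{real_inner, banach} \<Rightarrow> real ^ 'd \<Rightarrow> real"
    and evH :: "'h::{real_inner, banach} \<Rightarrow> real ^ 'd \<Rightarrow> real"
    and \<mu> :: "'f \<Rightarrow> 'h"
    and \<phi> \<phi>' \<phi>'' :: "real \<Rightarrow> real"
    and \<Phi> :: "'f \<Rightarrow> real"
  assumes "space \<nu> = X"
    and "function_space_on X evF"
    and "psd_kernel_on X k"
    and "bounded_kernel_on X k"
    and "rkhs_on X k evH"
    and "kernel_mean_embedding \<nu> k evF evH \<mu>"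
    and "bounded_linear \<mu>"
    and "\<And>r. r \<ge> 0 \<Longrightarrow> (\<phi> has_real_derivative \<phi>' r) (at r within {0..})"
    and "\<And>r. r \<ge> 0 \<Longrightarrow> (\<phi>' has_real_derivative \<phi>'' r) (at r within {0..})"
    and "continuous_on {0..} \<phi>''"
    and "mono_on {0..} \<phi>"
    and "\<phi>' 0 = 0"
    and "\<And>r. r > 0 \<Longrightarrow> \<phi>' r > 0"
    and "\<And>r. r > 0 \<Longrightarrow> \<phi>'' r > 0"
    and "\<And>f. \<Phi> f = \<phi> (norm (\<mu> f))"
  shows "\<forall>R>0.
     (\<forall>p \<in> mmd_ball \<mu> R. \<forall>q \<in> mmd_ball \<mu> R.
        m_const \<phi>' \<phi>'' R / 2 * ereal (mmd_sq \<mu> p q) \<le> ereal (bregman_div \<Phi> p q) \<and>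
        ereal (bregman_div \<Phi> p q) \<le> L_const \<phi>' \<phi>'' R / 2 * ereal (mmd_sq \<mu> p q)) \<and>
     (m_const \<phi>' \<phi>'' R > 0 \<and> L_const \<phi>' \<phi>'' R < \<infinity> \<longrightarrow>
        (\<exists>c>0. \<exists>C>0. \<forall>p \<in> mmd_ball \<mu> R. \<forall>q \<in> mmd_ball \<mu> R.
           c * mmd_sq \<mu> p q \<le> bregman_div \<Phi> p q \<and>
           bregman_div \<Phi> p q \<le> C * mmd_sq \<mu> p q))"
proof -
  note \<mu> = assms(7) and \<phi> = assms(8) and \<phi>' = assms(9) and \<phi>'0 = assms(12) and \<Phi> = assms(15)
  have bregman: "bregman_div \<Phi> p q =
      (\<phi> (norm (\<mu> p)) - \<phi> (norm (\<mu> q)) - \<phi>' (norm (\<mu> q)) * (norm (\<mu> p) - norm (\<mu> q)))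
      + lambda_perp \<phi>' \<phi>'' (norm (\<mu> q)) * (norm (\<mu> p) * norm (\<mu> q) - inner (\<mu> p) (\<mu> q))" for p q
    by (rule bregman_div_radial_comp[OF \<mu> \<phi> \<phi>'0 \<Phi>])
  let ?par = "lambda_par \<phi>''" and ?perp = "lambda_perp \<phi>' \<phi>''"
  let ?m = "m_const \<phi>' \<phi>''" and ?L = "L_const \<phi>' \<phi>''"
  have m_le: "?m R \<le> ereal (?par r)" "?m R \<le> ereal (?perp r)" if "r \<in> {0..R}" for r R
    using INF_lower[OF that, of "\<lambda>r. ereal (min (?par r) (?perp r))"]
    by (auto simp: m_const_def intro: order_trans)
  have le_L: "ereal (?par r) \<le> ?L R" "ereal (?perp r) \<le> ?L R" if "r \<in> {0..R}" for r R
    using SUP_upper[OF that, of "\<lambda>r. ereal (max (?par r) (?perp r))"]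
    by (auto simp: L_const_def intro: order_trans[rotated])
  have der: "(\<phi> has_real_derivative \<phi>' r) (at r within {0..R})"
    "(\<phi>' has_real_derivative \<phi>'' r) (at r within {0..R})" if "r \<in> {0..R}" for r R
    using that by (auto intro!: DERIV_subset[OF \<phi>] DERIV_subset[OF \<phi>'])
  \<comment> \<open>Needed for infinite constants: in \<open>ereal\<close>, infinity times 0 is 0,
    so both bounds then compare the divergence with 0. It is exactly 0 here because p and q have the
    same embedding.\<close>
  have degenerate: "bregman_div \<Phi> p q = 0" if "mmd_sq \<mu> p q = 0" for p q
    using that by (simp add: mmd_sq_def bregman power2_norm_eq_inner[symmetric] power2_eq_square)
  have lower: "m / 2 * mmd_sq \<mu> p q \<le> bregman_div \<Phi> p q"
    if m: "ereal m \<le> ?m R" and pq: "p \<in> mmd_ball \<mu> R" "q \<in> mmd_ball \<mu> R" for m R p q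
  proof -
    have in_R: "norm (\<mu> p) \<in> {0..R}" "norm (\<mu> q) \<in> {0..R}"
      using pq by (auto simp: mmd_ball_def)
    have bound: "m \<le> \<phi>'' r" "m \<le> ?perp r" if "r \<in> {0..R}" for r
      using m_le[OF that] m order_trans by (fastforce simp: lambda_par_def)+
    \<comment> \<open>The defect is nonnegative by Cauchy-Schwarz, so the bound on
      \<open>lambda_perp\<close> may be multiplied by it. Adding the radial Taylor bound gives
      \<open>m / 2\<close> times the sum of the squared norm difference and twice the defect, which
      is the squared MMD.\<close>
    have "m * (norm (\<mu> p) * norm (\<mu> q) - inner (\<mu> p) (\<mu> q))
        \<le> ?perp (norm (\<mu> q)) * (norm (\<mu> p) * norm (\<mu> q) - inner (\<mu> p) (\<mu> q))"
      by (rule mult_right_mono[OF bound(2)[OF in_R(2)]]) (simp add: norm_cauchy_schwarz)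
    with taylor_quadratic_lower[OF der in_R bound(1)] show ?thesis
      unfolding bregman mmd_sq_def norm_diff_sq_radial by (simp add: algebra_simps)
  qed
  have upper: "bregman_div \<Phi> p q \<le> M / 2 * mmd_sq \<mu> p q"
    if M: "?L R \<le> ereal M" and pq: "p \<in> mmd_ball \<mu> R" "q \<in> mmd_ball \<mu> R" for M R p q
  proof -
    have in_R: "norm (\<mu> p) \<in> {0..R}" "norm (\<mu> q) \<in> {0..R}"
      using pq by (auto simp: mmd_ball_def)
    have bound: "\<phi>'' r \<le> M" "?perp r \<le> M" if "r \<in> {0..R}" for r
      using le_L[OF that] M order_trans by (fastforce simp: lambda_par_def)+
    have "?perp (norm (\<mu> q)) * (norm (\<mu> p) * norm (\<mu> q) - inner (\<mu> p) (\<mu> q))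
        \<le> M * (norm (\<mu> p) * norm (\<mu> q) - inner (\<mu> p) (\<mu> q))"
      by (rule mult_right_mono[OF bound(2)[OF in_R(2)]]) (simp add: norm_cauchy_schwarz)
    with taylor_quadratic_upper[OF der in_R bound(1)] show ?thesis
      unfolding bregman mmd_sq_def norm_diff_sq_radial by (simp add: algebra_simps)
  qed
  show ?thesis
  proof (intro allI impI conjI ballI)
    fix R :: real and p q assume "R > 0" and pq: "p \<in> mmd_ball \<mu> R" "q \<in> mmd_ball \<mu> R"
    \<comment> \<open>Evaluating at \<open>r = 0\<close> excludes plus infinity for the infimum and
      minus infinity for the supremum; the remaining infinite values give trivial bounds unless the
      MMD vanishes.\<close>
    have 0: "0 \<in> {0..R}" using \<open>R > 0\<close> by simp
    have "mmd_sq \<mu> p q = 0 \<or> mmd_sq \<mu> p q > 0" by (auto simp: mmd_sq_def)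
    then show "?m R / 2 * ereal (mmd_sq \<mu> p q) \<le> ereal (bregman_div \<Phi> p q)"
      using lower[OF _ pq] m_le(1)[OF 0] degenerate by (cases "?m R") auto
    from \<open>mmd_sq \<mu> p q = 0 \<or> mmd_sq \<mu> p q > 0\<close>
    show "ereal (bregman_div \<Phi> p q) \<le> ?L R / 2 * ereal (mmd_sq \<mu> p q)"
      using upper[OF _ pq] le_L(1)[OF 0] degenerate by (cases "?L R") auto
  next
    fix R :: real assume "R > 0" and fin: "?m R > 0 \<and> ?L R < \<infinity>"
    have 0: "0 \<in> {0..R}" using \<open>R > 0\<close> by simp
    obtain m where m: "?m R = ereal m" using fin m_le(1)[OF 0] by (cases "?m R") auto
    obtain M where M: "?L R = ereal M" using fin le_L(1)[OF 0] by (cases "?L R") auto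
    \<comment> \<open>Both constants are compared with \<open>lambda_par\<close> at 0; the resulting
      \<open>m \<le> M\<close> makes the upper factor \<open>M / 2\<close> positive.\<close>
    have "0 < m" "m \<le> M"
      using fin m_le(1)[OF 0] le_L(1)[OF 0] unfolding m M by auto
    then show "\<exists>c>0. \<exists>C>0. \<forall>p \<in> mmd_ball \<mu> R. \<forall>q \<in> mmd_ball \<mu> R.
        c * mmd_sq \<mu> p q \<le> bregman_div \<Phi> p q \<and> bregman_div \<Phi> p q \<le> C * mmd_sq \<mu> p q"
      using lower[of m R] upper[of R M] m M by (intro exI[of _ "m/2"] exI[of _ "M/2"] conjI) auto
  qed
qed

end
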